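(* Let $m \geq 1$ be an integer and consider the continuous box game with resets $rCBox(m)$. For every integer $k \geq 1$, CBoxBreaker has a strategy which ensures that during the first $k$ rounds of the game every box has weight at most $1 + \log(m+k)$.
   Context: The game $rCBox(m)$ is played by CBoxMaker and CBoxBreaker on $m$ boxes $A_1, \ldots, A_m$, each of initial weight $0$. In each round, CBoxMaker changes the weight $w_i$ of each box $A_i$ to $w_i + \delta_i$, where $\delta_1, \ldots, \delta_m \geq 0$ are real numbers of his choice with $\sum_{i=1}^m \delta_i = 1$; then CBoxBreaker resets one box of his choice, i.e., sets its weight to $0$. $\log$ denotes the natural logarithm. *)

theory Defs
  imports Complex_Main
begin

text \<open>
  The boxes of \<open>rCBox(m)\<close> are indexed by \<open>{1..m}\<close>, and rounds are numbered from \<open>0\<close>, so the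
  first \<open>k\<close> rounds are those with number \<open>r < k\<close>. A move of CBoxMaker is the vector
  \<open>(\<delta>\<^sub>1, \<dots>, \<delta>\<^sub>m)\<close>, represented by the function that extends it by \<open>0\<close> to all of \<open>nat\<close>.
\<close>

definition maker_move :: "nat \<Rightarrow> (nat \<Rightarrow> real) \<Rightarrow> bool" where
  "maker_move m \<delta> \<longleftrightarrow>
     (\<forall>i\<in>{1..m}. \<delta> i \<ge> 0) \<and> (\<Sum>i = 1..m. \<delta> i) = 1 \<and> (\<forall>i. i \<notin> {1..m} \<longrightarrow> \<delta> i = 0)"

text \<open>
  A strategy of CBoxBreaker assigns to the list of all moves made so far by CBoxMaker, in
  chronological order and including the one of the current round, the box to reset. As the
  initial position is fixed and the strategy is deterministic, this list determines the whole
  history of the game.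
\<close>

definition breaker_strategy :: "nat \<Rightarrow> ((nat \<Rightarrow> real) list \<Rightarrow> nat) \<Rightarrow> bool" where
  "breaker_strategy m \<sigma> \<longleftrightarrow>
     (\<forall>h. h \<noteq> [] \<and> (\<forall>\<delta>\<in>set h. maker_move m \<delta>) \<longrightarrow> \<sigma> h \<in> {1..m})"

text \<open>
  The play in which CBoxMaker's move in round \<open>r\<close> is \<open>\<Delta> r\<close> and CBoxBreaker follows \<open>\<sigma>\<close>:
  \<open>weight \<sigma> \<Delta> r i\<close> is the weight of box \<open>i\<close> after \<open>r\<close> complete rounds, and
  \<open>weight_mid \<sigma> \<Delta> r i\<close> is its weight within round \<open>r\<close>, after CBoxMaker's move and before the
  reset.
\<close>

definition breaker_reset ::
    "((nat \<Rightarrow> real) list \<Rightarrow> nat) \<Rightarrow> (nat \<Rightarrow> nat \<Rightarrow> real) \<Rightarrow> nat \<Rightarrow> nat" where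
  "breaker_reset \<sigma> \<Delta> r = \<sigma> (map \<Delta> [0..<Suc r])"

primrec weight ::
    "((nat \<Rightarrow> real) list \<Rightarrow> nat) \<Rightarrow> (nat \<Rightarrow> nat \<Rightarrow> real) \<Rightarrow> nat \<Rightarrow> nat \<Rightarrow> real" where
  "weight \<sigma> \<Delta> 0 i = 0"
| "weight \<sigma> \<Delta> (Suc r) i =
     (if i = breaker_reset \<sigma> \<Delta> r then 0 else weight \<sigma> \<Delta> r i + \<Delta> r i)"

definition weight_mid ::
    "((nat \<Rightarrow> real) list \<Rightarrow> nat) \<Rightarrow> (nat \<Rightarrow> nat \<Rightarrow> real) \<Rightarrow> nat \<Rightarrow> nat \<Rightarrow> real" where
  "weight_mid \<sigma> \<Delta> r i = weight \<sigma> \<Delta> r i + \<Delta> r i"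

text \<open>
  ``During the first \<open>k\<close> rounds'' covers every position that occurs: the initial one, those
  between the two players' moves, and those at the end of a round. Quantifying over all
  sequences \<open>\<Delta>\<close> also covers adaptive play by CBoxMaker, since \<open>\<sigma>\<close> is deterministic.
\<close>

definition ensures_weights_at_most ::
    "nat \<Rightarrow> ((nat \<Rightarrow> real) list \<Rightarrow> nat) \<Rightarrow> nat \<Rightarrow> real \<Rightarrow> bool" where
  "ensures_weights_at_most m \<sigma> k B \<longleftrightarrow>
     (\<forall>\<Delta>. (\<forall>r<k. maker_move m (\<Delta> r)) \<longrightarrow>
        (\<forall>i\<in>{1..m}. (\<forall>r\<le>k. weight \<sigma> \<Delta> r i \<le> B) \<and> (\<forall>r<k. weight_mid \<sigma> \<Delta> r i \<le> B)))"

end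

theory Submission
  imports Defs
begin

text \<open>
  CBoxBreaker always resets a heaviest box. Add an infinite supply of dummy boxes of weight \<open>0\<close>.
  If \<open>a\<^sub>j(r)\<close> is the largest average weight of \<open>j\<close> boxes after \<open>r\<close> rounds, then resetting a maximum
  yields \<open>a\<^sub>j(r + 1) \<le> a\<^bsub>j+1\<^esub>(r) + 1 / (j + 1)\<close>, because the removed box is at least as heavy as the
  average of the \<open>j + 1\<close> boxes. Since \<open>1 / (j + 1) \<le> log ((j + 1) / j)\<close>, this telescopes to
  \<open>a\<^sub>j(r) \<le> log ((j + r) / j)\<close>. With \<open>j = 1\<close> no box exceeds \<open>1 + log k\<close> during the first \<open>k\<close> rounds.
\<close>

definition heaviest :: "nat \<Rightarrow> (nat \<Rightarrow> real) \<Rightarrow> nat" where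
  "heaviest m w = (SOME i. i \<in> {1..m} \<and> (\<forall>j\<in>{1..m}. w j \<le> w i))"

lemma heaviest:
  assumes "m \<ge> 1"
  shows "heaviest m w \<in> {1..m}" and "j \<in> {1..m} \<Longrightarrow> w j \<le> w (heaviest m w)"
proof -
  have "Max (w ` {1..m}) \<in> w ` {1..m}"
    using assms by (intro Max_in) auto
  then obtain i where "i \<in> {1..m}" "w i = Max (w ` {1..m})"
    by auto
  then have "i \<in> {1..m} \<and> (\<forall>j\<in>{1..m}. w j \<le> w i)"
    by auto
  then have "heaviest m w \<in> {1..m} \<and> (\<forall>j\<in>{1..m}. w j \<le> w (heaviest m w))"
    unfolding heaviest_def by (rule someI)
  then show "heaviest m w \<in> {1..m}" and "j \<in> {1..m} \<Longrightarrow> w j \<le> w (heaviest m w)"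
    by auto
qed

definition greedy_step :: "nat \<Rightarrow> (nat \<Rightarrow> real) \<Rightarrow> (nat \<Rightarrow> real) \<Rightarrow> nat \<Rightarrow> real" where
  "greedy_step m w \<delta> = (\<lambda>i. w i + \<delta> i)(heaviest m (\<lambda>i. w i + \<delta> i) := 0)"

text \<open>A strategy sees only CBoxMaker's moves, so the weights before the current round are
  recomputed by replaying \<open>butlast h\<close>; \<open>last h\<close> is the current
  move.\<close>

definition greedy :: "nat \<Rightarrow> (nat \<Rightarrow> real) list \<Rightarrow> nat" where
  "greedy m h = heaviest m (\<lambda>i. foldl (greedy_step m) (\<lambda>_. 0) (butlast h) i + last h i)"

lemma breaker_strategy_greedy: "m \<ge> 1 \<Longrightarrow> breaker_strategy m (greedy m)"
  by (simp only: breaker_strategy_def greedy_def heaviest(1)) simp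

text \<open>Links the replay inside \<open>greedy\<close> to the actual play, so that the reset box
  really is heaviest in the current position.\<close>

lemma weight_greedy:
  "weight (greedy m) \<Delta> r = foldl (greedy_step m) (\<lambda>_. 0) (map \<Delta> [0..<r])"
proof (induction r)
  case (Suc r)
  have "breaker_reset (greedy m) \<Delta> r = heaviest m (\<lambda>i. weight (greedy m) \<Delta> r i + \<Delta> r i)"
    unfolding Suc by (simp add: breaker_reset_def greedy_def)
  then have "weight (greedy m) \<Delta> (Suc r) = greedy_step m (weight (greedy m) \<Delta> r) (\<Delta> r)"
    by (intro ext) (simp add: greedy_step_def)
  then show ?case
    by (simp add: Suc)
qed (simp add: fun_eq_iff)

lemma breaker_reset_greedy:
  "breaker_reset (greedy m) \<Delta> r = heaviest m (weight_mid (greedy m) \<Delta> r)"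
proof -
  have "weight_mid (greedy m) \<Delta> r = (\<lambda>i. weight (greedy m) \<Delta> r i + \<Delta> r i)"
    by (rule ext) (simp add: weight_mid_def)
  then show ?thesis
    by (simp add: breaker_reset_def greedy_def weight_greedy)
qed

lemma maker_move_nonneg: "maker_move m \<delta> \<Longrightarrow> \<delta> i \<ge> 0"
  by (cases "i \<in> {1..m}") (auto simp: maker_move_def)

lemma sum_maker_move_le:
  assumes "maker_move m \<delta>" "finite S"
  shows "sum \<delta> S \<le> 1"
proof -
  have "sum \<delta> S \<le> sum \<delta> (S \<union> {1..m})"
    using assms by (intro sum_mono2) (auto intro: maker_move_nonneg)
  also have "\<dots> = sum \<delta> {1..m}"
    using assms by (intro sum.mono_neutral_right) (auto simp: maker_move_def)
  finally show ?thesis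
    using assms by (simp add: maker_move_def)
qed

lemma weight_nonneg:
  "(\<And>s. s < r \<Longrightarrow> maker_move m (\<Delta> s)) \<Longrightarrow> weight \<sigma> \<Delta> r i \<ge> 0"
  by (induction r) (simp_all add: maker_move_nonneg[of m])

text \<open>Indices outside \<open>{1..m}\<close> serve as the dummy boxes: moves vanish there, and
  a reset can only give 0.\<close>

lemma weight_outside:
  "(\<And>s. s < r \<Longrightarrow> maker_move m (\<Delta> s)) \<Longrightarrow> i \<notin> {1..m} \<Longrightarrow> weight \<sigma> \<Delta> r i = 0"
  by (induction r) (auto simp: maker_move_def)

lemma weight_mid_nonneg:
  "(\<And>s. s \<le> r \<Longrightarrow> maker_move m (\<Delta> s)) \<Longrightarrow> weight_mid \<sigma> \<Delta> r i \<ge> 0"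
  unfolding weight_mid_def
  by (intro add_nonneg_nonneg weight_nonneg[of r m] maker_move_nonneg[of m]) auto

lemma weight_mid_outside:
  "(\<And>s. s \<le> r \<Longrightarrow> maker_move m (\<Delta> s)) \<Longrightarrow> i \<notin> {1..m} \<Longrightarrow> weight_mid \<sigma> \<Delta> r i = 0"
  using weight_outside[of r m \<Delta> i \<sigma>] by (auto simp: weight_mid_def maker_move_def)

lemma inverse_Suc_le_ln_diff:
  assumes "n \<ge> 1"
  shows "1 / real (Suc n) \<le> ln (real (Suc n)) - ln (real n)"
proof -
  \<comment> \<open>This is \<open>ln x \<le> x - 1\<close> at
    \<open>x = n / (n + 1)\<close>.\<close>
  have "ln (real n / real (Suc n)) \<le> real n / real (Suc n) - 1"
    using assms by (intro ln_le_minus_one) simp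
  also have "\<dots> = - (1 / real (Suc n))"
    by (simp add: field_simps)
  finally show ?thesis
    using assms by (simp add: ln_div)
qed

text \<open>The removed value is at least the average of the others, so the average cannot rise;
  both averages are cleared of denominators.\<close>

lemma sum_remove_max_le:
  fixes f :: "'a \<Rightarrow> real"
  assumes "finite T" "b \<in> T" "\<And>i. i \<in> T \<Longrightarrow> f i \<le> f b"
  shows "real (card T) * sum f (T - {b}) \<le> real (card T - 1) * sum f T"
proof -
  have "card T > 0"
    using assms by (auto simp: card_gt_0_iff)
  then obtain k where k: "card T = Suc k"
    using gr0_implies_Suc by blast
  have "sum f (T - {b}) \<le> real k * f b"
    using sum_bounded_above[of "T - {b}" f "f b"] assms k by simp
  moreover have "sum f T = f b + sum f (T - {b})"
    using assms by (simp add: sum.remove)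
  ultimately show ?thesis
    by (simp add: k distrib_left distrib_right)
qed

text \<open>\<open>S\<close> may contain dummy boxes, so a set with one more element always exists,
  even when \<open>card S \<ge> m\<close>. The induction needs \<open>S\<close> arbitrary because it
  passes to that larger set.\<close>

lemma sum_weight_greedy_le:
  assumes "m \<ge> 1" "\<And>s. s < r \<Longrightarrow> maker_move m (\<Delta> s)"
    and "finite S" "S \<noteq> {}"
  shows "sum (weight (greedy m) \<Delta> r) S
    \<le> real (card S) * (ln (real (card S + r)) - ln (real (card S)))"
  using assms(2-)
proof (induction r arbitrary: S)
  case (Suc r)
  let ?w = "weight (greedy m) \<Delta>" and ?f = "weight_mid (greedy m) \<Delta> r"
  define b where "b = breaker_reset (greedy m) \<Delta> r"
  define n where "n = card S"
  have n: "n \<ge> 1"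
    using Suc.prems(2,3) by (simp add: n_def Suc_le_eq card_gt_0_iff)
  have moves: "maker_move m (\<Delta> s)" if "s \<le> r" for s
    using that Suc.prems(1) by simp
  \<comment> \<open>The maximum over the real boxes is nonnegative, hence also dominates every dummy
    box.\<close>
  have b: "?f j \<le> ?f b" for j
  proof (cases "j \<in> {1..m}")
    case True
    then show ?thesis
      using heaviest(2)[OF assms(1)] by (simp only: b_def breaker_reset_greedy)
  next
    case False
    then show ?thesis
      using weight_mid_outside[OF moves] weight_mid_nonneg[OF moves] by simp
  qed
  \<comment> \<open>If \<open>b\<close> already lies in \<open>S\<close>, the extra element of \<open>T\<close> is an arbitrary, possibly dummy, box.\<close>
  obtain T where T: "finite T" "S \<subseteq> T" "b \<in> T" "card T = Suc n"
  proof (cases "b \<in> S")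
    case True
    obtain c where "c \<notin> S"
      using ex_new_if_finite[OF infinite_UNIV_nat Suc.prems(2)] by blast
    then show ?thesis
      using True Suc.prems(2) by (intro that[of "insert c S"]) (auto simp: n_def)
  next
    case False
    then show ?thesis
      using False Suc.prems(2) by (intro that[of "insert b S"]) (auto simp: n_def)
  qed
  \<comment> \<open>After the reset, \<open>b\<close> contributes 0.\<close>
  have "sum (?w (Suc r)) S = sum ?f (S - {b})"
    using Suc.prems(2)
    by (intro sum.mono_neutral_cong_right) (auto simp: b_def weight_mid_def)
  also have "\<dots> \<le> sum ?f (T - {b})"
    using T weight_mid_nonneg[OF moves] by (intro sum_mono2) auto
  finally have "real (Suc n) * sum (?w (Suc r)) S \<le> real (Suc n) * sum ?f (T - {b})"
    by (intro mult_left_mono) auto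
  also have "\<dots> \<le> real n * sum ?f T"
    using sum_remove_max_le[OF T(1,3), of ?f] b T(4) by simp
  also have "\<dots> = real n * (sum (?w r) T + sum (\<Delta> r) T)"
    by (simp add: weight_mid_def sum.distrib)
  also have "\<dots> \<le> real n *
      (real (Suc n) * (ln (real (Suc n + r)) - ln (real (Suc n))) + 1)"
  proof (intro mult_left_mono add_mono)
    show "sum (?w r) T \<le> real (Suc n) * (ln (real (Suc n + r)) - ln (real (Suc n)))"
      unfolding T(4)[symmetric]
      by (rule Suc.IH) (use moves T in auto)
    show "sum (\<Delta> r) T \<le> 1"
      using sum_maker_move_le[OF moves[OF order_refl] T(1)] .
  qed simp
  also have "\<dots> = real (Suc n) *
      (real n * (ln (real (Suc n + r)) - ln (real (Suc n)) + 1 / real (Suc n)))"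
    by (simp add: field_simps del: of_nat_Suc)
  finally have "sum (?w (Suc r)) S
      \<le> real n * (ln (real (Suc n + r)) - ln (real (Suc n)) + 1 / real (Suc n))"
    by (rule mult_left_le_imp_le) simp
  \<comment> \<open>The terms \<open>ln (real (Suc n))\<close> cancel, and
    \<open>Suc n + r = n + Suc r\<close>.\<close>
  also have "\<dots> \<le> real n * (ln (real (n + Suc r)) - ln (real n))"
    using inverse_Suc_le_ln_diff[OF n] by (intro mult_left_mono) simp_all
  finally show ?case
    by (simp add: n_def)
qed simp

lemma weight_greedy_le:
  assumes "m \<ge> 1" "\<And>s. s < r \<Longrightarrow> maker_move m (\<Delta> s)"
  shows "weight (greedy m) \<Delta> r i \<le> ln (real (Suc r))"
  using sum_weight_greedy_le[where m = m and r = r and \<Delta> = \<Delta> and S = "{i}"] assms by simp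

lemma ensures_weights_at_most_greedy:
  assumes "m \<ge> 1" "k \<ge> 1"
  shows "ensures_weights_at_most m (greedy m) k (1 + ln (real m + real k))"
  unfolding ensures_weights_at_most_def
proof (intro allI impI ballI conjI)
  fix \<Delta> i r
  assume moves: "\<forall>r<k. maker_move m (\<Delta> r)"
  have le: "weight (greedy m) \<Delta> s i \<le> ln (real m + real k)" if "s \<le> k" for s
  proof -
    have "weight (greedy m) \<Delta> s i \<le> ln (real (Suc s))"
      using assms moves that by (intro weight_greedy_le) auto
    \<comment> \<open>Here \<open>s + 1 \<le> k + m\<close>, as \<open>m \<ge> 1\<close>.\<close>
    also have "\<dots> \<le> ln (real m + real k)"
      using assms that by simp
    finally show ?thesis .
  qed
  show "weight (greedy m) \<Delta> r i \<le> 1 + ln (real m + real k)" if "r \<le> k"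
    using le[OF that] by simp
  \<comment> \<open>The summand 1 pays for the move of the current round, before the reset.\<close>
  show "weight_mid (greedy m) \<Delta> r i \<le> 1 + ln (real m + real k)" if "r < k"
    using le[of r] sum_maker_move_le[of m "\<Delta> r" "{i}"] moves that
    by (simp add: weight_mid_def)
qed

theorem theorem2p7:
  fixes m :: nat
  assumes "m \<ge> 1"
  shows "\<forall>k::nat. k \<ge> 1 \<longrightarrow>
    (\<exists>\<sigma>. breaker_strategy m \<sigma> \<and> ensures_weights_at_most m \<sigma> k (1 + ln (real m + real k)))"
  using assms breaker_strategy_greedy ensures_weights_at_most_greedy by blast

end
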